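(* Let $(X,d)$ be a metric space, $\delta$ a semimetric on $X$, and $T\colon X\to X$ a mapping. Suppose there exists $K_*\ge1$ such that for all $x,y\in X$ with $Tx\ne Ty$, $$\frac1{K_*}\le\frac{d(Tx,Ty)}{\delta(Tx,Ty)}\le K_*.$$ Let $T$ satisfy the multiplicative contraction condition $$d(Tx,Ty)\,\delta(Tx,Ty)\le\beta\,d(x,y)\,\delta(x,y)\quad\text{for all }x,y\in X,$$ with $\beta\in[0,1)$. If $\beta<\frac{4K_*}{(K_*+1)^2}$, then $T$ is an additive contraction: $$d(Tx,Ty)+\delta(Tx,Ty)\le\beta'\,\big(d(x,y)+\delta(x,y)\big)\quad\text{for all }x,y\in X,$$ with $\beta'=\frac{K_*+1}{2\sqrt{K_*}}\cdot\sqrt\beta<1$.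
   Context: A semimetric on a nonempty set $X$ is a map $\delta\colon X\times X\to[0,\infty)$ such that $\delta(x,y)=0$ if and only if $x=y$, and $\delta(x,y)=\delta(y,x)$ for all $x,y\in X$ (no triangle inequality is required). *)

theory Defs
  imports "HOL-Analysis.Abstract_Metric_Spaces" "HOL-Library.FuncSet"
begin

text \<open>Only the values of \<open>\<delta>\<close> on \<open>X \<times> X\<close> are constrained; they are junk elsewhere.\<close>

locale Semimetric_space =
  fixes X :: "'a set" and \<delta> :: "'a \<Rightarrow> 'a \<Rightarrow> real"
  assumes nonempty: "X \<noteq> {}"
    and nonneg: "\<lbrakk>x \<in> X; y \<in> X\<rbrakk> \<Longrightarrow> 0 \<le> \<delta> x y"
    and zero: "\<lbrakk>x \<in> X; y \<in> X\<rbrakk> \<Longrightarrow> \<delta> x y = 0 \<longleftrightarrow> x = y"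
    and commute: "\<lbrakk>x \<in> X; y \<in> X\<rbrakk> \<Longrightarrow> \<delta> x y = \<delta> y x"

end

(* If a and b are within a factor K of each other, then (K b - a) (K a - b) >= 0, which rearranges to
   K (a + b)^2 <= (K + 1)^2 a b, a converse of AM-GM. Chaining it with the multiplicative contraction
   and then AM-GM for d(x,y) and delta(x,y) gives the square of the additive contraction. *)
theory Submission
  imports Defs
begin

lemma reverse_am_gm:
  fixes a b K :: real
  assumes "a \<le> K * b" "b \<le> K * a"
  shows "K * (a + b)\<^sup>2 \<le> (K + 1)\<^sup>2 * (a * b)"
proof -
  \<comment> \<open>The product equals the right side minus the left side of the goal exactly, since
    the terms \<open>2 * K * a * b\<close> cancel; equality holds when one number is
    \<open>K\<close> times the other.\<close>
  have "0 \<le> (K * b - a) * (K * a - b)"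
    using assms by simp
  then show ?thesis
    by (simp add: power2_eq_square algebra_simps)
qed

theorem theorem5p4:
  fixes X :: "'a set" and d \<delta> :: "'a \<Rightarrow> 'a \<Rightarrow> real" and T :: "'a \<Rightarrow> 'a"
    and K \<beta> :: real
  assumes "Metric_space X d"
    and "Semimetric_space X \<delta>"
    and "T \<in> X \<rightarrow> X"
    and "K \<ge> 1"
    and "\<And>x y. \<lbrakk>x \<in> X; y \<in> X; T x \<noteq> T y\<rbrakk> \<Longrightarrow>
           1 / K \<le> d (T x) (T y) / \<delta> (T x) (T y) \<and> d (T x) (T y) / \<delta> (T x) (T y) \<le> K"
    and "0 \<le> \<beta>" and "\<beta> < 1"
    and "\<And>x y. \<lbrakk>x \<in> X; y \<in> X\<rbrakk> \<Longrightarrow>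
           d (T x) (T y) * \<delta> (T x) (T y) \<le> \<beta> * (d x y * \<delta> x y)"
    and "\<beta> < 4 * K / (K + 1)^2"
  shows "let \<beta>' = (K + 1) / (2 * sqrt K) * sqrt \<beta> in
           \<beta>' < 1 \<and>
           (\<forall>x\<in>X. \<forall>y\<in>X. d (T x) (T y) + \<delta> (T x) (T y) \<le> \<beta>' * (d x y + \<delta> x y))"
proof -
  interpret d: Metric_space X d by fact
  interpret s: Semimetric_space X \<delta> by fact
  define \<beta>' where "\<beta>' = (K + 1) / (2 * sqrt K) * sqrt \<beta>"
  have K: "K > 0" using assms(4) by simp
  have \<beta>'_nonneg: "0 \<le> \<beta>'"
    using K assms(6) by (simp add: \<beta>'_def)
  \<comment> \<open>Squaring removes both roots. The factor \<open>(K + 1)\<^sup>2 / K\<close> will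
    come from \<open>reverse_am_gm\<close> and the 4 from AM-GM; the assumed bound on \<beta> says
    precisely that this square is below 1.\<close>
  have \<beta>'_sq: "\<beta>'\<^sup>2 = (K + 1)\<^sup>2 * \<beta> / (4 * K)"
    using K assms(6) by (simp add: \<beta>'_def power_mult_distrib power_divide)
  have "\<beta>'\<^sup>2 < 1"
    unfolding \<beta>'_sq using K assms(9) by (simp add: pos_less_divide_eq mult.commute)
  then have "\<beta>' < 1"
    by (simp add: abs_square_less_1)
  moreover have "d (T x) (T y) + \<delta> (T x) (T y) \<le> \<beta>' * (d x y + \<delta> x y)"
    if xy: "x \<in> X" "y \<in> X" for x y
  proof (cases "T x = T y")
    case True
    then show ?thesis
      using xy assms(3) s.zero[of "T x" "T x"] s.nonneg[of x y] \<beta>'_nonneg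
      by (auto simp: Pi_iff)
  next
    case False
    define a b p q where "a = d (T x) (T y)" and "b = \<delta> (T x) (T y)"
      and "p = d x y" and "q = \<delta> x y"
    have TX: "T x \<in> X" "T y \<in> X" using xy assms(3) by auto
    have b: "b > 0"
      using s.nonneg[OF TX] s.zero[OF TX] False by (simp add: b_def)
    have pq: "0 \<le> p" "0 \<le> q" using s.nonneg xy by (simp_all add: p_def q_def)
    \<comment> \<open>As \<open>b > 0\<close>, the denominators clear, and the two-sided ratio bound
      becomes a pair of inequalities symmetric in \<open>a\<close> and \<open>b\<close>.\<close>
    have "a \<le> K * b" "b \<le> K * a"
      using assms(5)[OF xy False] b K unfolding a_def b_def by (simp_all add: field_simps)
    then have "K * (a + b)\<^sup>2 \<le> (K + 1)\<^sup>2 * (a * b)"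
      by (rule reverse_am_gm)
    also have "\<dots> \<le> (K + 1)\<^sup>2 * (\<beta> * (p * q))"
      using assms(8)[OF xy] by (intro mult_left_mono) (simp_all add: a_def b_def p_def q_def)
    also have "\<dots> \<le> (K + 1)\<^sup>2 * (\<beta> * ((p + q)\<^sup>2 / 4))"
    proof -
      have "p * q \<le> (p + q)\<^sup>2 / 4"
        using sum_squares_bound[of p q] by (simp add: power2_sum)
      then show ?thesis
        using assms(6) by (intro mult_left_mono) simp_all
    qed
    \<comment> \<open>The constants collected along the chain are \<open>K\<close> times the square
      of \<open>\<beta>'\<close>, so \<open>K\<close> cancels from both ends.\<close>
    also have "\<dots> = K * (\<beta>' * (p + q))\<^sup>2"
      unfolding power_mult_distrib \<beta>'_sq using K by simp
    finally have "(a + b)\<^sup>2 \<le> (\<beta>' * (p + q))\<^sup>2"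
      using K by (rule mult_left_le_imp_le)
    \<comment> \<open>Taking roots needs only that the right side is nonnegative.\<close>
    then have "a + b \<le> \<beta>' * (p + q)"
      by (rule power2_le_imp_le) (use \<beta>'_nonneg pq in simp)
    then show ?thesis by (simp add: a_def b_def p_def q_def)
  qed
  ultimately show ?thesis
    unfolding Let_def \<beta>'_def[symmetric] by blast
qed

end
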